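(* Let $n\in\mathbb{N}$ and let $U\subset\mathbb{R}^n$ be a $0$-symmetric closed convex body which is a tile. Then, for $0$-symmetric closed convex bodies $V\subset\mathbb{R}^n$, $$C_n(U,V)=2^n(1+o(1))\quad\text{as}\quad |V|\to\infty.$$
   Context: $|A|$ denotes the volume of a body $A\subset\mathbb{R}^n$. A set $A$ is $0$-symmetric if $A=-A$. A continuous function $f:\mathbb{R}^n\to\mathbb{C}$ is positive definite if for every finite $Y\subset\mathbb{R}^n$ and all complex numbers $\{c_a: a\in Y\}$ one has $\sum_{a,b\in Y}c_a\overline{c_b}f(a-b)\ge 0$. A double positive definite function, written $f\succeq 0$, is a continuous positive definite function $f$ on $\mathbb{R}^n$ with values in $\mathbb{R}_+=[0,\infty)$. For $0$-symmetric closed convex bodies $U,V\subset\mathbb{R}^n$, $$C_n(U,V):=\sup_{f\succeq 0,\ f\ne 0}\frac{\frac{1}{|V|}\int_V f(x)\,dx}{\frac{1}{|U|}\int_U f(x)\,dx}.$$ A lattice of rank $n$ is a set $\Lambda=M\mathbb{Z}^n$ with $M\in\mathbb{R}^{n\times n}$, $\det M\neq 0$. A $0$-symmetric convex body $P\subset\mathbb{R}^n$ is a tile if there is a lattice $\Lambda$ of rank $n$ such that $P+\Lambda$ is a lattice tiling, i.e. both a packing ($a-b\notin\operatorname{int}(2P)$ for all distinct $a,b\in\Lambda$) and a covering ($\mathbb{R}^n\subseteq P+\Lambda$).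
   Formalization: "As |V|→∞" is taken to mean that V grows in all directions (V eventually contains every ball), uniformly in V; for n≥2 large volume alone fails, e.g. for U=[-1,1]² and V=[-1/8,1/8]×[-L,L], where C_2(U,V)≥8 for every L. *)

theory Defs
  imports "HOL-Analysis.Analysis" "HOL-Library.Landau_Symbols"
begin

definition positive_definite :: "(real ^ 'n \<Rightarrow> complex) \<Rightarrow> bool" where
  "positive_definite f \<longleftrightarrow> continuous_on UNIV f \<and>
     (\<forall>Y c. finite Y \<longrightarrow> (\<Sum>a\<in>Y. \<Sum>b\<in>Y. c a * cnj (c b) * f (a - b)) \<in> \<real>\<^sub>\<ge>\<^sub>0)"

definition double_positive_definite :: "(real ^ 'n \<Rightarrow> real) \<Rightarrow> bool" where
  "double_positive_definite f \<longleftrightarrow>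
     positive_definite (\<lambda>x. complex_of_real (f x)) \<and> (\<forall>x. 0 \<le> f x)"

text \<open>A body is compact with nonempty interior, so that its volume is finite and positive.\<close>

definition symmetric_convex_body :: "(real ^ 'n) set \<Rightarrow> bool" where
  "symmetric_convex_body A \<longleftrightarrow>
     compact A \<and> convex A \<and> interior A \<noteq> {} \<and> A = uminus ` A"

definition average :: "(real ^ 'n) set \<Rightarrow> (real ^ 'n \<Rightarrow> real) \<Rightarrow> real" where
  "average A f = (1 / measure lborel A) * (LINT x:A|lborel. f x)"

text \<open>The supremum is taken in the extended reals, so no boundedness is presupposed. For a body
  \<open>U\<close> and an admissible \<open>f\<close> the denominator is positive, since \<open>f 0 > 0\<close>.\<close>

definition doubling_constant :: "(real ^ 'n) set \<Rightarrow> (real ^ 'n) set \<Rightarrow> ereal" where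
  "doubling_constant U V =
     (SUP f \<in> {f. double_positive_definite f \<and> f \<noteq> (\<lambda>x. 0)}. ereal (average V f / average U f))"

definition is_lattice :: "(real ^ 'n) set \<Rightarrow> bool" where
  "is_lattice \<Lambda> \<longleftrightarrow>
     (\<exists>M :: real ^ 'n ^ 'n. det M \<noteq> 0 \<and> \<Lambda> = (\<lambda>z. M *v z) ` {z. \<forall>i. z $ i \<in> \<int>})"

definition lattice_packing :: "(real ^ 'n) set \<Rightarrow> (real ^ 'n) set \<Rightarrow> bool" where
  "lattice_packing P \<Lambda> \<longleftrightarrow>
     (\<forall>a\<in>\<Lambda>. \<forall>b\<in>\<Lambda>. a \<noteq> b \<longrightarrow> a - b \<notin> interior ((\<lambda>x. 2 *\<^sub>R x) ` P))"

definition lattice_covering :: "(real ^ 'n) set \<Rightarrow> (real ^ 'n) set \<Rightarrow> bool" where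
  "lattice_covering P \<Lambda> \<longleftrightarrow> UNIV \<subseteq> {p + a | p a. p \<in> P \<and> a \<in> \<Lambda>}"

definition tile :: "(real ^ 'n) set \<Rightarrow> bool" where
  "tile P \<longleftrightarrow> symmetric_convex_body P \<and>
     (\<exists>\<Lambda>. is_lattice \<Lambda> \<and> lattice_packing P \<Lambda> \<and> lattice_covering P \<Lambda>)"

text \<open>The mode of convergence ``\<open>|V|\<close> tends to infinity'': \<open>V\<close> ranges over all 0-symmetric convex
  bodies and grows in every direction, i.e. eventually contains each given ball. Large volume
  alone would admit arbitrarily thin bodies in dimension at least 2, for which the doubling
  constant is unbounded: with \<open>U = [-1,1]^2\<close>, \<open>V = [-e,e] * [-L,L]\<close> and the tent function
  \<open>f x = max 0 (1 - \<bar>x\<^sub>1\<bar> / e)\<close>, \<open>0 < e \<le> 1\<close>, the quotient of the averages is \<open>1 / e\<close>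
  for every \<open>L > 0\<close>. The lemmas below show that the volume does tend to infinity along this
  filter, that dilations of a fixed body converge along it, and that in dimension 1 it is
  exactly the filter of bodies whose volume tends to infinity.\<close>

definition bodies_to_infinity :: "(real ^ 'n) set filter" where
  "bodies_to_infinity = (INF R. principal {V. symmetric_convex_body V \<and> cball 0 R \<subseteq> V})"

lemma eventually_bodies_to_infinity:
  "eventually P bodies_to_infinity \<longleftrightarrow>
     (\<exists>R. \<forall>V. symmetric_convex_body V \<and> cball 0 R \<subseteq> V \<longrightarrow> P V)"
proof -
  have "eventually P bodies_to_infinity \<longleftrightarrow>
      (\<exists>R\<in>UNIV. eventually P (principal {V. symmetric_convex_body V \<and> cball 0 R \<subseteq> V}))"
    unfolding bodies_to_infinity_def
  proof (rule eventually_INF_base)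
    fix r s :: real
    show "\<exists>x\<in>UNIV. principal {V :: (real ^ 'a) set. symmetric_convex_body V \<and> cball 0 x \<subseteq> V}
        \<le> inf (principal {V. symmetric_convex_body V \<and> cball 0 r \<subseteq> V})
              (principal {V. symmetric_convex_body V \<and> cball 0 s \<subseteq> V})"
      by (rule bexI[of _ "max r s"]) (auto simp: subset_iff)
  qed simp
  then show ?thesis by (auto simp: eventually_principal)
qed

lemma bodies_to_infinity_neq_bot: "(bodies_to_infinity :: (real ^ 'n) set filter) \<noteq> bot"
proof -
  have "\<exists>V :: (real ^ 'n) set. symmetric_convex_body V \<and> cball 0 R \<subseteq> V" for R
  proof (intro exI conjI)
    show "symmetric_convex_body (cball (0 :: real ^ 'n) (max R 1))"
      unfolding symmetric_convex_body_def
    proof (intro conjI)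
      show "cball (0 :: real ^ 'n) (max R 1) = uminus ` cball 0 (max R 1)"
        by (auto simp: image_iff intro!: bexI[of _ "- x" for x])
    qed auto
  qed auto
  then show ?thesis
    unfolding trivial_limit_def eventually_bodies_to_infinity by blast
qed

lemma volume_bodies_to_infinity:
  "filterlim (\<lambda>V :: (real ^ 'n) set. measure lborel V) at_top bodies_to_infinity"
  unfolding filterlim_at_top eventually_bodies_to_infinity
proof (intro allI)
  fix Z :: real
  let ?u = "unit_ball_vol (real DIM(real ^ 'n))"
  have u: "?u > 0" by (intro unit_ball_vol_pos) simp
  define R where "R = max 1 (Z / ?u)"
  have "Z = ?u * (Z / ?u)" using u by (simp del: unit_ball_vol_pos)
  also have "\<dots> \<le> ?u * R" using u by (intro mult_left_mono) (auto simp: R_def)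
  also have "\<dots> \<le> ?u * R ^ DIM(real ^ 'n)"
    using u by (intro mult_left_mono self_le_power) (auto simp: R_def)
  also have "\<dots> = measure lborel (cball (0 :: real ^ 'n) R)"
    by (subst content_cball) (auto simp: R_def)
  finally have Z: "Z \<le> measure lborel (cball (0 :: real ^ 'n) R)" .
  have "Z \<le> measure lborel V" if "symmetric_convex_body V" "cball 0 R \<subseteq> V" for V :: "(real ^ 'n) set"
  proof -
    have V: "compact V" using that(1) by (simp add: symmetric_convex_body_def)
    have "measure lborel (cball (0 :: real ^ 'n) R) \<le> measure lborel V"
    proof (rule measure_mono_fmeasurable[OF that(2)])
      show "V \<in> fmeasurable lborel"
        using V emeasure_compact_finite[OF V] by (auto simp: fmeasurable_def compact_imp_closed)
    qed simp
    with Z show ?thesis by simp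
  qed
  then show "\<exists>R. \<forall>V :: (real ^ 'n) set. symmetric_convex_body V \<and> cball 0 R \<subseteq> V \<longrightarrow> Z \<le> measure lborel V"
    by blast
qed

lemma symmetric_convex_body_contains_ball:
  assumes "symmetric_convex_body V"
  obtains e where "e > 0" "cball 0 e \<subseteq> V"
proof -
  have cv: "convex V" and sym: "V = uminus ` V" and ne: "interior V \<noteq> {}"
    using assms by (auto simp: symmetric_convex_body_def)
  from ne obtain x e where e: "e > 0" "cball x e \<subseteq> V"
    by (meson ex_in_conv mem_interior_cball)
  have "y \<in> V" if "y \<in> cball 0 e" for y
  proof -
    have "x + y \<in> V" "x - y \<in> V" using e(2) that by (auto simp: subset_iff dist_norm)
    then have "- (x - y) \<in> V" using sym by blast
    with \<open>x + y \<in> V\<close> cv have "(1/2) *\<^sub>R (x + y) + (1/2) *\<^sub>R (- (x - y)) \<in> V"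
      by (intro convexD) auto
    moreover have "(1/2) *\<^sub>R (x + y) + (1/2) *\<^sub>R (- (x - y)) = y"
      by (simp add: vec_eq_iff field_simps)
    ultimately show ?thesis by simp
  qed
  with e(1) that show thesis by blast
qed

lemma dilations_bodies_to_infinity:
  fixes V :: "(real ^ 'n) set"
  assumes "symmetric_convex_body V"
  shows "filterlim (\<lambda>r :: real. (\<lambda>x. r *\<^sub>R x) ` V) bodies_to_infinity at_top"
  unfolding filterlim_iff eventually_bodies_to_infinity
proof (intro allI impI, elim exE)
  fix P :: "(real ^ 'n) set \<Rightarrow> bool" and R :: real
  assume P: "\<forall>V. symmetric_convex_body V \<and> cball 0 R \<subseteq> V \<longrightarrow> P V"
  obtain e where e: "e > 0" "cball 0 e \<subseteq> V"
    using symmetric_convex_body_contains_ball[OF assms] .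
  show "\<forall>\<^sub>F r in at_top. P ((\<lambda>x. r *\<^sub>R x) ` V)"
    using eventually_gt_at_top[of "max 0 (R / e)"]
  proof eventually_elim
    case (elim r)
    then have r: "r > 0" "R \<le> r * e" using e by (auto simp: field_simps)
    have ball: "cball 0 (r * e) \<subseteq> (\<lambda>x. r *\<^sub>R x) ` V"
    proof
      fix y :: "real ^ 'n" assume "y \<in> cball 0 (r * e)"
      then have "(1 / r) *\<^sub>R y \<in> cball 0 e" using r by (simp add: field_simps)
      with e(2) have "(1 / r) *\<^sub>R y \<in> V" by blast
      then have "r *\<^sub>R ((1 / r) *\<^sub>R y) \<in> (\<lambda>x. r *\<^sub>R x) ` V" by (rule imageI)
      then show "y \<in> (\<lambda>x. r *\<^sub>R x) ` V" using r by simp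
    qed
    then have "cball 0 R \<subseteq> (\<lambda>x. r *\<^sub>R x) ` V"
      using r(2) by (meson order_trans subset_cball)
    moreover have "symmetric_convex_body ((\<lambda>x. r *\<^sub>R x) ` V)"
      unfolding symmetric_convex_body_def
    proof (intro conjI)
      show "compact ((\<lambda>x. r *\<^sub>R x) ` V)" "convex ((\<lambda>x. r *\<^sub>R x) ` V)"
        using assms by (auto simp: symmetric_convex_body_def compact_scaling convex_scaling)
      show "interior ((\<lambda>x. r *\<^sub>R x) ` V) \<noteq> {}"
        using ball r(1) e(1) by (metis empty_iff mem_interior_cball mult_pos_pos)
      have "uminus ` (\<lambda>x. r *\<^sub>R x) ` V = (\<lambda>x. r *\<^sub>R x) ` uminus ` V"
        by (simp add: image_image)
      then show "(\<lambda>x. r *\<^sub>R x) ` V = uminus ` (\<lambda>x. r *\<^sub>R x) ` V"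
        using assms by (metis symmetric_convex_body_def)
    qed
    ultimately show ?case using P by blast
  qed
qed

lemma bodies_to_infinity_dim_1:
  assumes "CARD('n) = 1"
  shows "(bodies_to_infinity :: (real ^ 'n) set filter) =
           inf (filtercomap (measure lborel) at_top) (principal {V. symmetric_convex_body V})"
proof (rule antisym)
  have "\<forall>\<^sub>F V :: (real ^ 'n) set in bodies_to_infinity. symmetric_convex_body V"
    unfolding eventually_bodies_to_infinity by blast
  then show "(bodies_to_infinity :: (real ^ 'n) set filter)
      \<le> inf (filtercomap (measure lborel) at_top) (principal {V. symmetric_convex_body V})"
    using volume_bodies_to_infinity by (simp add: filterlim_iff_le_filtercomap le_principal)
next
  show "inf (filtercomap (measure lborel) at_top) (principal {V. symmetric_convex_body V})
      \<le> (bodies_to_infinity :: (real ^ 'n) set filter)"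
  proof (rule filter_leI)
    fix P assume "eventually P (bodies_to_infinity :: (real ^ 'n) set filter)"
    then obtain R where
      R: "\<And>V. symmetric_convex_body V \<Longrightarrow> cball (0 :: real ^ 'n) R \<subseteq> V \<Longrightarrow> P V"
      unfolding eventually_bodies_to_infinity by blast
    let ?M = "measure lborel (cball (0 :: real ^ 'n) R)"
    have "P V" if V: "symmetric_convex_body V" and vol: "measure lborel V > ?M" for V
    proof (rule R[OF V], rule ccontr)
      assume "\<not> cball 0 R \<subseteq> V"
      then obtain x where x: "norm x \<le> R" "x \<notin> V" by (auto simp: subset_iff)
      obtain k :: 'n where k: "UNIV = {k}" using assms by (metis card_1_singletonE)
      have nrm: "norm v = \<bar>v $ k\<bar>" for v :: "real ^ 'n"
        by (simp add: norm_vec_def L2_set_def k)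
      have eqk: "v = w \<longleftrightarrow> v $ k = w $ k" for v w :: "real ^ 'n"
        unfolding vec_eq_iff using k by (metis UNIV_I singletonD)
      have "V \<subseteq> cball 0 R"
      proof
        fix y assume y: "y \<in> V"
        show "y \<in> cball 0 R"
        proof (rule ccontr)
          assume "y \<notin> cball 0 R"
          then have ynx: "\<bar>x $ k\<bar> < \<bar>y $ k\<bar>" using x by (simp add: nrm)
          define t where "t = (1 + x $ k / y $ k) / 2"
          have y0: "y $ k \<noteq> 0" using ynx by auto
          have "\<bar>x $ k / y $ k\<bar> \<le> 1" using ynx y0 by (simp add: field_simps)
          then have "- 1 \<le> x $ k / y $ k" "x $ k / y $ k \<le> 1" by (simp_all only: abs_le_iff) linarith
          then have t: "0 \<le> t" "0 \<le> 1 - t" by (simp_all add: t_def)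
          have "- y \<in> V" using y V unfolding symmetric_convex_body_def by blast
          then have "t *\<^sub>R y + (1 - t) *\<^sub>R (- y) \<in> V"
            using y V t unfolding symmetric_convex_body_def by (intro convexD) auto
          moreover have "t *\<^sub>R y + (1 - t) *\<^sub>R (- y) = x"
            using y0 by (simp add: eqk t_def field_simps)
          ultimately show False using x by simp
        qed
      qed
      then have "measure lborel V \<le> ?M"
        using V emeasure_compact_finite[of "cball (0 :: real ^ 'n) R"]
        by (intro measure_mono_fmeasurable)
          (auto simp: symmetric_convex_body_def compact_imp_closed fmeasurable_def)
      with vol show False by simp
    qed
    then show "eventually P (inf (filtercomap (measure lborel) at_top)
        (principal {V. symmetric_convex_body V}))"
      unfolding eventually_inf_principal eventually_filtercomap
      by (intro exI[of _ "\<lambda>r. r > ?M"]) (auto simp: eventually_gt_at_top)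
  qed
qed

end

theory Submission
  imports Defs
begin

text \<open>
Write \<open>n\<close> for the dimension and \<open>C\<close> for the doubling constant of \<open>U\<close> and \<open>V\<close>. For every
\<open>0 < \<eta> < 1\<close>, as soon as \<open>V\<close> contains \<open>(2 / \<eta>) U\<close>,
\<open>2 ^ n * ((1 - \<eta>) / (1 + \<eta>)) ^ n \<le> C \<le> 2 ^ n * (1 + \<eta>) ^ n\<close>. A bounded set is absorbed
in this way by all bodies that contain a large enough ball, so letting \<open>\<eta>\<close> tend to \<open>0\<close> gives the limit.

Upper bound (\<open>doubling_constant_le\<close>). Convolve \<open>f\<close> with the indicator functions of \<open>U / 2\<close> and
of its reflection. The result \<open>H\<close> is positive definite, so \<open>H y \<le> H 0\<close> for all \<open>y\<close>. Since \<open>U / 2 - U / 2 = U\<close>,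
\<open>H 0\<close> is at most \<open>\<bar>U / 2\<bar>\<close> times the integral of \<open>f\<close> over \<open>U\<close>; and by Fubini the integral of
\<open>H\<close> over \<open>V + U\<close> is at least \<open>\<bar>U / 2\<bar>\<^sup>2\<close> times the integral of \<open>f\<close> over \<open>V\<close>. Hence \<open>C\<close> is at
most \<open>(\<bar>V + U\<bar> / \<bar>V\<bar>) * (\<bar>U\<bar> / \<bar>U / 2\<bar>)\<close>, where the first factor is close to \<open>1\<close> and the second is \<open>2 ^ n\<close>.

Lower bound (\<open>doubling_constant_tile_ge\<close>). If \<open>U\<close> tiles with the lattice \<open>\<Lambda>\<close>, then \<open>\<Lambda> / 2\<close> has
density \<open>2 ^ n / \<bar>U\<bar>\<close> and, after a slight dilation to clear the boundary, meets \<open>U\<close> only in \<open>0\<close>. A double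
positive definite function concentrated near this lattice therefore has a single peak in \<open>U\<close> and about
\<open>2 ^ n * \<bar>V\<bar> / \<bar>U\<bar>\<close> equal peaks in \<open>V\<close>. Such a function is a high power of
\<open>(1 + (\<Sum>i. cos (2 * pi * x\<^sub>i)) / n) / 2\<close>, where the \<open>x\<^sub>i\<close> are the lattice coordinates of \<open>x\<close>
(\<open>lattice_peak_function\<close>): it is nonnegative, and positive definite as a combination of characters with
nonnegative coefficients.
\<close>

section \<open>Finite inequalities for positive definite functions\<close>

text \<open>The definition sums over a set of points, but translating a configuration of points by \<open>y\<close> and
joining it to the original one may make points coincide; indexed families allow for that.
Coinciding points are merged by adding their coefficients.\<close>

lemma positive_definite_family:
  assumes f: "positive_definite f" and I: "finite I"
  shows "(\<Sum>i\<in>I. \<Sum>j\<in>I. c i * cnj (c j) * f (x i - x j)) \<in> \<real>\<^sub>\<ge>\<^sub>0"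
proof -
  define d where "d a = (\<Sum>i | i \<in> I \<and> x i = a. c i)" for a
  have "(\<Sum>i\<in>I. \<Sum>j\<in>I. c i * cnj (c j) * f (x i - x j)) =
      (\<Sum>a\<in>x ` I. \<Sum>i | i \<in> I \<and> x i = a. \<Sum>b\<in>x ` I. \<Sum>j | j \<in> I \<and> x j = b.
        c i * cnj (c j) * f (x i - x j))"
    by (simp only: sum.image_gen[OF I, of _ x, symmetric])
  also have "\<dots> = (\<Sum>a\<in>x ` I. \<Sum>i | i \<in> I \<and> x i = a. \<Sum>b\<in>x ` I. c i * cnj (d b) * f (a - b))"
    unfolding d_def cnj_sum sum_distrib_left sum_distrib_right by (intro sum.cong refl) auto
  also have "\<dots> = (\<Sum>a\<in>x ` I. \<Sum>b\<in>x ` I. d a * cnj (d b) * f (a - b))"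
    by (intro sum.cong refl, subst sum.swap) (simp add: d_def sum_distrib_right)
  also have "\<dots> \<in> \<real>\<^sub>\<ge>\<^sub>0"
    using f I by (simp add: positive_definite_def)
  finally show ?thesis .
qed

context
  fixes f :: "real ^ 'n \<Rightarrow> real"
  assumes f: "double_positive_definite f"
begin

lemma double_positive_definite_continuous: "continuous_on UNIV f"
proof -
  have "continuous_on UNIV (\<lambda>x. Re (complex_of_real (f x)))"
    using f unfolding double_positive_definite_def positive_definite_def
    by (intro continuous_on_Re) auto
  then show ?thesis by simp
qed

lemma double_positive_definite_nonneg: "0 \<le> f x"
  using f by (simp add: double_positive_definite_def)

lemma double_positive_definite_family:
  assumes "finite I"
  shows "(\<Sum>i\<in>I. \<Sum>j\<in>I. c i * cnj (c j) * complex_of_real (f (x i - x j))) \<in> \<real>\<^sub>\<ge>\<^sub>0"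
  using f assms positive_definite_family[of "\<lambda>x. complex_of_real (f x)" I c x]
  by (simp add: double_positive_definite_def)

lemma double_positive_definite_even: "f (- x) = f x"
proof -
  \<comment> \<open>With the coefficients \<open>1\<close> and \<open>\<i>\<close> the imaginary part of the quadratic form is \<open>f x - f (- x)\<close>.\<close>
  define c where "c b = (if b then \<i> else 1)" for b
  define p where "p b = (if b then x else 0)" for b
  have "(\<Sum>i\<in>UNIV. \<Sum>j\<in>UNIV. c i * cnj (c j) * complex_of_real (f (p i - p j))) \<in> \<real>\<^sub>\<ge>\<^sub>0"
    by (rule double_positive_definite_family) simp
  then have "Im (\<Sum>i\<in>UNIV. \<Sum>j\<in>UNIV. c i * cnj (c j) * complex_of_real (f (p i - p j))) = 0"
    by (simp add: complex_nonneg_Reals_iff)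
  then show ?thesis by (simp add: UNIV_bool c_def p_def)
qed

lemma double_positive_definite_le_0: "f x \<le> f 0"
proof -
  define c :: "bool \<Rightarrow> complex" where "c b = (if b then -1 else 1)" for b
  define p where "p b = (if b then x else 0)" for b
  have "(\<Sum>i\<in>UNIV. \<Sum>j\<in>UNIV. c i * cnj (c j) * complex_of_real (f (p i - p j))) \<in> \<real>\<^sub>\<ge>\<^sub>0"
    by (rule double_positive_definite_family) simp
  then show ?thesis
    by (simp add: complex_nonneg_Reals_iff UNIV_bool c_def p_def double_positive_definite_even)
qed

text \<open>Give the points \<open>p i\<close> the masses \<open>m i\<close> and their translates \<open>p i + y\<close> the masses \<open>- m i\<close>. The
quadratic form of this signed configuration is twice the right-hand side, minus the left-hand side
for \<open>y\<close>, minus the left-hand side for \<open>- y\<close>; the last two agree because \<open>f\<close> is even.\<close>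

lemma double_positive_definite_sum_shift_le:
  fixes m :: "'i \<Rightarrow> real"
  assumes I: "finite I"
  shows "(\<Sum>i\<in>I. \<Sum>j\<in>I. m i * m j * f (y + p i - p j)) \<le> (\<Sum>i\<in>I. \<Sum>j\<in>I. m i * m j * f (p i - p j))"
proof -
  define S where "S z = (\<Sum>i\<in>I. \<Sum>j\<in>I. m i * m j * f (z + p i - p j))" for z
  define c where "c = (\<lambda>(i, b). complex_of_real (if b then - m i else m i))"
  define q where "q = (\<lambda>(i, b). if b then p i + y else p i)"
  have "S (- y) = (\<Sum>i\<in>I. \<Sum>j\<in>I. m i * m j * f (- (y + p j - p i)))"
    by (simp add: S_def algebra_simps)
  also have "\<dots> = S y"
    unfolding double_positive_definite_even S_def by (subst sum.swap) (simp add: mult_ac)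
  finally have even: "S (- y) = S y" .
  have *: "c i * cnj (c j) = complex_of_real (Re (c i) * Re (c j))" for i j
    by (simp add: c_def split: prod.split)
  have "(\<Sum>i\<in>I \<times> UNIV. \<Sum>j\<in>I \<times> UNIV. c i * cnj (c j) * complex_of_real (f (q i - q j))) \<in> \<real>\<^sub>\<ge>\<^sub>0"
    by (rule double_positive_definite_family) (simp add: I)
  then have "0 \<le> (\<Sum>i\<in>I \<times> UNIV. \<Sum>j\<in>I \<times> UNIV. Re (c i) * Re (c j) * f (q i - q j))"
    unfolding * by (simp only: complex_nonneg_Reals_iff Re_sum of_real_mult[symmetric] Re_complex_of_real)
  also have "\<dots> = S 0 - S y - S (- y) + S 0"
    unfolding sum.cartesian_product' UNIV_bool
    by (simp add: c_def q_def S_def sum.distrib sum_subtractf sum_negf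
        sum_distrib_left algebra_simps)
  finally show ?thesis using even by (simp add: S_def)
qed

end

section \<open>Integral inequalities for positive definite functions\<close>

lemma integral_simple_function_comp:
  fixes g :: "'b \<Rightarrow> real"
  assumes M: "finite_measure M" and phi: "simple_function M \<phi>"
  shows "(\<integral>t. g (\<phi> t) \<partial>M) =
    (\<Sum>b\<in>\<phi> ` space M. measure M (\<phi> -` {b} \<inter> space M) * g b)"
proof -
  interpret finite_measure M by fact
  have fin: "finite (\<phi> ` space M)" and meas: "\<And>b. \<phi> -` {b} \<inter> space M \<in> sets M"
    using phi by (auto dest: simple_functionD)
  have "(\<integral>t. g (\<phi> t) \<partial>M) =
      (\<integral>t. (\<Sum>b\<in>\<phi> ` space M. indicator (\<phi> -` {b} \<inter> space M) t * g b) \<partial>M)"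
  proof (rule Bochner_Integration.integral_cong[OF refl])
    fix t assume t: "t \<in> space M"
    have "(\<Sum>b\<in>\<phi> ` space M. indicator (\<phi> -` {b} \<inter> space M) t * g b) =
        (\<Sum>b\<in>\<phi> ` space M. if b = \<phi> t then g b else 0)"
      by (intro sum.cong) (auto simp: t indicator_def)
    then show "g (\<phi> t) = (\<Sum>b\<in>\<phi> ` space M. indicator (\<phi> -` {b} \<inter> space M) t * g b)"
      using t fin by simp
  qed
  also have "\<dots> = (\<Sum>b\<in>\<phi> ` space M. measure M (\<phi> -` {b} \<inter> space M) * g b)"
    using meas by (subst Bochner_Integration.integral_sum)
      (auto simp: emeasure_eq_measure intro!: integrable_mult_left integrable_real_indicator)
  finally show ?thesis .
qed

lemma double_positive_definite_borel_measurable: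
  "double_positive_definite f \<Longrightarrow> f \<in> borel_measurable borel"
  by (intro borel_measurable_continuous_onI double_positive_definite_continuous)

text \<open>The double integral is the value at \<open>y\<close> of the convolution of \<open>f\<close> with \<open>M\<close> and its
reflection, a positive definite function, so it is largest at \<open>0\<close>. Approximating the identity map
pointwise by simple functions turns both integrals into finite sums; since \<open>f\<close> is bounded by
\<open>f 0\<close> and \<open>M\<close> is finite, dominated convergence carries the inequality to the limit.\<close>

lemma double_positive_definite_integral_shift_le:
  fixes M :: "(real ^ 'n) measure"
  assumes f: "double_positive_definite f" and M: "finite_measure M"
    and sets [measurable_cong, simp]: "sets M = sets borel"
  shows "(\<integral>s. \<integral>t. f (y + s - t) \<partial>M \<partial>M) \<le> (\<integral>s. \<integral>t. f (s - t) \<partial>M \<partial>M)"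
proof -
  interpret finite_measure M by fact
  note [measurable] = double_positive_definite_borel_measurable[OF f]
  note cont = double_positive_definite_continuous[OF f]
  have bound: "\<bar>f x\<bar> \<le> f 0" for x
    using double_positive_definite_le_0[OF f] double_positive_definite_nonneg[OF f] by simp
  obtain \<phi> :: "nat \<Rightarrow> real ^ 'n \<Rightarrow> real ^ 'n"
    where phi: "\<And>i. simple_function M (\<phi> i)" "\<And>x. (\<lambda>i. \<phi> i x) \<longlonglongrightarrow> x"
    using borel_measurable_implies_sequence_metric[where f = "\<lambda>x. x" and M = M and z = 0] sets_eq_imp_space_eq[OF sets]
    by auto
  have [measurable]: "\<phi> i \<in> borel_measurable M" for i
    using phi(1) by (rule borel_measurable_simple_function)
  define J where "J \<psi> y = (\<integral>s. \<integral>t. f (y + \<psi> s - \<psi> t) \<partial>M \<partial>M)" for \<psi> :: "real ^ 'n \<Rightarrow> real ^ 'n" and y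
  have J_le: "J (\<phi> i) y \<le> J (\<phi> i) 0" for i
  proof -
    have "J (\<phi> i) z = (\<Sum>a\<in>\<phi> i ` space M. \<Sum>b\<in>\<phi> i ` space M.
        measure M (\<phi> i -` {a} \<inter> space M) * measure M (\<phi> i -` {b} \<inter> space M) * f (z + a - b))" for z
      unfolding J_def integral_simple_function_comp[OF M phi(1), of "\<lambda>b. f (z + _ - b)"]
      by (subst integral_simple_function_comp[OF M phi(1),
            of "\<lambda>a. \<Sum>b\<in>\<phi> i ` space M. measure M (\<phi> i -` {b} \<inter> space M) * f (z + a - b)"])
         (simp add: sum_distrib_left mult_ac)
    then show ?thesis
      using double_positive_definite_sum_shift_le[OF f simple_functionD(1)[OF phi(1)], where p = "\<lambda>x. x"]
      by simp
  qed
  have inner: "(\<lambda>i. \<integral>t. f (z + \<phi> i s - \<phi> i t) \<partial>M) \<longlonglongrightarrow> (\<integral>t. f (z + s - t) \<partial>M)" for z s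
    by (rule integral_dominated_convergence[where w = "\<lambda>_. f 0"])
       (auto simp: bound intro!: isCont_tendsto_compose[of _ f] tendsto_intros phi
          cont[unfolded continuous_on_eq_continuous_at[OF open_UNIV], rule_format])
  have J_lim: "(\<lambda>i. J (\<phi> i) z) \<longlonglongrightarrow> J (\<lambda>x. x) z" for z
    unfolding J_def
  proof (rule integral_dominated_convergence[where w = "\<lambda>_. \<integral>t. f 0 \<partial>M"])
    show "AE s in M. norm (\<integral>t. f (z + \<phi> i s - \<phi> i t) \<partial>M) \<le> (\<integral>t. f 0 \<partial>M)" for i
    proof (intro always_eventually allI)
      fix s
      have "integrable M (\<lambda>t. f (z + \<phi> i s - \<phi> i t))"
        by (rule integrable_const_bound[where B = "f 0"]) (auto simp: bound)
      then show "norm (\<integral>t. f (z + \<phi> i s - \<phi> i t) \<partial>M) \<le> (\<integral>t. f 0 \<partial>M)"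
        by (intro Bochner_Integration.integral_norm_bound_integral) (auto simp: bound)
    qed
  qed (auto simp: inner)
  have "J (\<lambda>x. x) y \<le> J (\<lambda>x. x) 0"
    by (rule LIMSEQ_le[OF J_lim J_lim]) (use J_le in auto)
  then show ?thesis by (simp add: J_def)
qed

lemma double_positive_definite_nn_integral_shift_le:
  fixes M :: "(real ^ 'n) measure"
  assumes f: "double_positive_definite f" and M: "finite_measure M"
    and sets [measurable_cong, simp]: "sets M = sets borel"
  shows "(\<integral>\<^sup>+s. \<integral>\<^sup>+t. f (y + s - t) \<partial>M \<partial>M) \<le> (\<integral>\<^sup>+s. \<integral>\<^sup>+t. f (s - t) \<partial>M \<partial>M)"
proof -
  interpret finite_measure M by fact
  note [measurable] = double_positive_definite_borel_measurable[OF f]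
  note nonneg = double_positive_definite_nonneg[OF f]
  have bound: "\<bar>f x\<bar> \<le> f 0" for x
    using double_positive_definite_le_0[OF f] nonneg by simp
  have int: "integrable M (\<lambda>t. f (z + s - t))" for z s
    by (rule integrable_const_bound[where B = "f 0"]) (auto simp: bound)
  have "integrable M (\<lambda>s. \<integral>t. f (z + s - t) \<partial>M)" for z
  proof (rule integrable_const_bound[where B = "\<integral>t. f 0 \<partial>M"])
    show "AE s in M. norm (\<integral>t. f (z + s - t) \<partial>M) \<le> (\<integral>t. f 0 \<partial>M)"
    proof (intro always_eventually allI)
      show "norm (\<integral>t. f (z + s - t) \<partial>M) \<le> (\<integral>t. f 0 \<partial>M)" for s
        using int[of z s] by (intro Bochner_Integration.integral_norm_bound_integral) (auto simp: bound)
    qed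
  qed auto
  then have "(\<integral>\<^sup>+s. \<integral>\<^sup>+t. f (z + s - t) \<partial>M \<partial>M) = ennreal (\<integral>s. \<integral>t. f (z + s - t) \<partial>M \<partial>M)" for z
    by (simp add: nn_integral_eq_integral int nonneg)
  from this[of y] this[of 0] show ?thesis
    using double_positive_definite_integral_shift_le[OF f M sets, of y] by (simp add: ennreal_leI)
qed

lemma nn_integral_lborel_translation:
  fixes c :: "'a::euclidean_space"
  assumes [measurable]: "g \<in> borel_measurable borel"
  shows "(\<integral>\<^sup>+x. g (c + x) \<partial>lborel) = (\<integral>\<^sup>+x. g x \<partial>lborel)"
  by (subst (2) lborel_distr_plus[of c, symmetric]) (simp add: nn_integral_distr)

text \<open>Let \<open>H y\<close> be the integral of \<open>f (y + s - t)\<close> over \<open>s, t \<in> A\<close>, so that \<open>H y \<le> H 0\<close>. For fixed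
\<open>s\<close> the differences stay in \<open>U\<close>, whence \<open>H 0 \<le> \<bar>A\<bar> * (\<integral>x\<in>U. f x)\<close>; and integrating
\<open>H\<close> over \<open>W\<close> sweeps out \<open>V\<close> for each pair \<open>s, t\<close>, whence
\<open>\<bar>A\<bar>\<^sup>2 * (\<integral>x\<in>V. f x) \<le> \<bar>W\<bar> * H 0\<close>.\<close>

lemma double_positive_definite_nn_integral_le:
  fixes A U V W :: "(real ^ 'n) set"
  assumes f: "double_positive_definite f"
    and [measurable]: "A \<in> sets borel" "U \<in> sets borel" "V \<in> sets borel" "W \<in> sets borel"
    and fin: "emeasure lborel A < \<infinity>"
    and U: "\<And>s t. s \<in> A \<Longrightarrow> t \<in> A \<Longrightarrow> s - t \<in> U"
    and W: "\<And>v s t. v \<in> V \<Longrightarrow> s \<in> A \<Longrightarrow> t \<in> A \<Longrightarrow> v + (s - t) \<in> W"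
  shows "emeasure lborel A * (\<integral>\<^sup>+x\<in>V. f x \<partial>lborel) \<le> emeasure lborel W * (\<integral>\<^sup>+x\<in>U. f x \<partial>lborel)"
proof (cases "emeasure lborel A = 0")
  case False
  note [measurable] = double_positive_definite_borel_measurable[OF f]
  define M where "M = density lborel (indicator A :: _ \<Rightarrow> ennreal)"
  have sets [measurable_cong, simp]: "sets M = sets borel" by (simp add: M_def)
  have M: "finite_measure M"
    using fin by (intro finite_measureI) (simp add: M_def emeasure_density)
  interpret finite_measure M by fact
  interpret pair_sigma_finite lborel M ..
  have AE: "AE s in M. s \<in> A"
    unfolding M_def by (subst AE_density) (auto simp: indicator_def)
  have const: "(\<integral>\<^sup>+s. c \<partial>M) = c * emeasure lborel A" for c
    by (simp add: M_def emeasure_density)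
  let ?H = "\<lambda>y. \<integral>\<^sup>+s. \<integral>\<^sup>+t. f (y + s - t) \<partial>M \<partial>M"
  let ?IU = "\<integral>\<^sup>+x\<in>U. f x \<partial>lborel" and ?IV = "\<integral>\<^sup>+x\<in>V. f x \<partial>lborel"
  \<comment> \<open>The integral over \<open>U\<close> bounds \<open>H 0\<close>: evenness of \<open>f\<close> replaces \<open>f (s - t)\<close> by \<open>f (t - s)\<close>,
    and then \<open>t - s\<close> runs through a translate of \<open>A\<close> that lies in \<open>U\<close>.\<close>
  have H0: "?H 0 \<le> ?IU * emeasure lborel A"
  proof -
    have "(\<integral>\<^sup>+t. f (s - t) \<partial>M) \<le> ?IU" if s: "s \<in> A" for s
    proof -
      have "(\<integral>\<^sup>+t. f (s - t) \<partial>M) = (\<integral>\<^sup>+t. indicator A t * ennreal (f (- (s - t))) \<partial>lborel)"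
        unfolding double_positive_definite_even[OF f] by (simp add: M_def nn_integral_density)
      also have "\<dots> = (\<integral>\<^sup>+x. indicator A (s + x) * ennreal (f (- (s - (s + x)))) \<partial>lborel)"
        by (subst nn_integral_lborel_translation) auto
      also have "\<dots> \<le> ?IU"
      proof (rule nn_integral_mono)
        fix x show "indicator A (s + x) * ennreal (f (- (s - (s + x)))) \<le> ennreal (f x) * indicator U x"
          using U[of "s + x" s] s by (auto simp: indicator_def)
      qed
      finally show ?thesis .
    qed
    then have "?H 0 \<le> (\<integral>\<^sup>+s. ?IU \<partial>M)"
      using AE by (intro nn_integral_mono_AE) auto
    then show ?thesis by (simp only: const)
  qed
  have "?IV * emeasure lborel A * emeasure lborel A = (\<integral>\<^sup>+s. \<integral>\<^sup>+t. ?IV \<partial>M \<partial>M)"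
    by (simp only: const)
  also have "\<dots> \<le> (\<integral>\<^sup>+s. \<integral>\<^sup>+t. \<integral>\<^sup>+y. ennreal (f (y + s - t)) * indicator W y \<partial>lborel \<partial>M \<partial>M)"
  proof -
    have "?IV \<le> (\<integral>\<^sup>+y. ennreal (f (y + s - t)) * indicator W y \<partial>lborel)" if st: "s \<in> A" "t \<in> A" for s t
    proof -
      have "?IV \<le> (\<integral>\<^sup>+x. ennreal (f (((t - s) + x) + s - t)) * indicator W ((t - s) + x) \<partial>lborel)"
      proof (rule nn_integral_mono)
        fix x show "ennreal (f x) * indicator V x \<le> ennreal (f (((t - s) + x) + s - t)) * indicator W ((t - s) + x)"
          using W[of x t s] st by (auto simp: indicator_def algebra_simps)
      qed
      also have "\<dots> = (\<integral>\<^sup>+y. ennreal (f (y + s - t)) * indicator W y \<partial>lborel)"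
        by (subst nn_integral_lborel_translation) auto
      finally show ?thesis .
    qed
    then have "(\<integral>\<^sup>+t. ?IV \<partial>M) \<le> (\<integral>\<^sup>+t. \<integral>\<^sup>+y. ennreal (f (y + s - t)) * indicator W y \<partial>lborel \<partial>M)" if "s \<in> A" for s
      using AE that by (intro nn_integral_mono_AE) auto
    then show ?thesis
      using AE by (intro nn_integral_mono_AE) auto
  qed
  also have "\<dots> = (\<integral>\<^sup>+s. \<integral>\<^sup>+y. \<integral>\<^sup>+t. ennreal (f (y + s - t)) * indicator W y \<partial>M \<partial>lborel \<partial>M)"
    by (subst Fubini') auto
  also have "\<dots> = (\<integral>\<^sup>+y. \<integral>\<^sup>+s. \<integral>\<^sup>+t. ennreal (f (y + s - t)) * indicator W y \<partial>M \<partial>M \<partial>lborel)"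
    by (subst Fubini') auto
  also have "\<dots> = (\<integral>\<^sup>+y\<in>W. ?H y \<partial>lborel)"
    by (simp add: nn_integral_multc)
  also have "\<dots> \<le> (\<integral>\<^sup>+y\<in>W. ?H 0 \<partial>lborel)"
    by (rule nn_integral_mono)
       (use double_positive_definite_nn_integral_shift_le[OF f M sets] in \<open>auto intro!: mult_right_mono\<close>)
  also have "\<dots> = ?H 0 * emeasure lborel W"
    by (simp add: nn_integral_cmult)
  also have "\<dots> \<le> ?IU * emeasure lborel A * emeasure lborel W"
    using H0 by (intro mult_right_mono) auto
  finally have "emeasure lborel A * (emeasure lborel A * ?IV) \<le> emeasure lborel A * (emeasure lborel W * ?IU)"
    by (simp add: mult_ac)
  then show ?thesis
    using fin False by (subst (asm) ennreal_mult_le_mult_iff) auto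
qed simp

section \<open>Symmetric convex bodies and the upper bound\<close>

lemma symmetric_convex_bodyD:
  assumes "symmetric_convex_body V"
  shows "compact V" "convex V" "x \<in> V \<Longrightarrow> - x \<in> V"
  using assms unfolding symmetric_convex_body_def by blast+

lemma zero_in_interior_symmetric_convex_body:
  assumes "symmetric_convex_body V"
  shows "0 \<in> interior V"
  using symmetric_convex_body_contains_ball[OF assms] mem_interior_cball by metis

lemma compact_fmeasurable_lborel:
  fixes S :: "'a::euclidean_space set"
  shows "compact S \<Longrightarrow> S \<in> fmeasurable lborel"
  using emeasure_compact_finite[of S] by (auto simp: fmeasurable_def compact_imp_closed)

lemma measure_symmetric_convex_body_pos:
  fixes V :: "(real ^ 'n) set"
  assumes "symmetric_convex_body V"
  shows "0 < measure lborel V"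
proof -
  obtain e where e: "e > 0" "cball 0 e \<subseteq> V"
    using symmetric_convex_body_contains_ball[OF assms] .
  have "0 < measure lborel (cball (0 :: real ^ 'n) e)"
    using e(1) by (simp add: content_cball)
  also have "\<dots> \<le> measure lborel V"
    using e(2) compact_fmeasurable_lborel[OF symmetric_convex_bodyD(1)[OF assms]]
    by (intro measure_mono_fmeasurable) auto
  finally show ?thesis .
qed

lemma measure_lborel_scaleR_image:
  fixes S :: "(real ^ 'n) set"
  assumes "compact S" "0 \<le> c"
  shows "measure lborel ((*\<^sub>R) c ` S) = c ^ CARD('n) * measure lborel S"
proof -
  have "compact ((*\<^sub>R) c ` S)" using assms(1) by (rule compact_scaling)
  then show ?thesis
    using measure_lebesgue_affine[of c 0 S] assms
    by (simp add: measure_completion compact_imp_closed)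
qed

lemma measure_lborel_translation_image:
  fixes S :: "(real ^ 'n) set"
  assumes "compact S"
  shows "measure lborel ((+) c ` S) = measure lborel S"
proof -
  have "compact ((+) c ` S)" using assms by (rule compact_translation)
  then show ?thesis
    using measure_translation[of c S] assms
    by (simp add: measure_completion compact_imp_closed)
qed

lemma set_nn_integral_compact_eq_integral:
  fixes f :: "real ^ 'n \<Rightarrow> real"
  assumes "compact S" "continuous_on S f" "\<And>x. 0 \<le> f x"
  shows "(\<integral>\<^sup>+x\<in>S. f x \<partial>lborel) = ennreal (LINT x:S|lborel. f x)"
proof -
  have "(\<integral>\<^sup>+x\<in>S. f x \<partial>lborel) = (\<integral>\<^sup>+x. ennreal (indicator S x *\<^sub>R f x) \<partial>lborel)"
    by (intro nn_integral_cong) (simp add: indicator_def)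
  also have "\<dots> = ennreal (LINT x:S|lborel. f x)"
    unfolding set_lebesgue_integral_def
    using assms by (intro nn_integral_eq_integral borel_integrable_compact) auto
  finally show ?thesis .
qed

text \<open>Once \<open>V\<close> contains \<open>(1 / \<eta>) U\<close>, the Minkowski sum \<open>V + U\<close> is swallowed by the dilate
\<open>(1 + \<eta>) V\<close>, whose volume is known. This replaces any estimate for the volume of a sum of bodies.\<close>

lemma convex_add_scaled:
  assumes V: "convex V" and v: "v \<in> V" and u: "(1 / \<eta>) *\<^sub>R u \<in> V" and eta: "0 < \<eta>"
  shows "v + u \<in> (*\<^sub>R) (1 + \<eta>) ` V"
proof
  show "(1 / (1 + \<eta>)) *\<^sub>R v + (\<eta> / (1 + \<eta>)) *\<^sub>R ((1 / \<eta>) *\<^sub>R u) \<in> V"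
    using V v u by (rule convexD) (use eta in \<open>auto simp: field_simps\<close>)
  show "v + u = (1 + \<eta>) *\<^sub>R ((1 / (1 + \<eta>)) *\<^sub>R v + (\<eta> / (1 + \<eta>)) *\<^sub>R ((1 / \<eta>) *\<^sub>R u))"
    using eta by (simp add: scaleR_add_right)
qed

text \<open>The integral inequality with \<open>A = U / 2\<close> and \<open>W = (1 + \<eta>) V\<close>: the factor \<open>2 ^ n\<close> is
\<open>\<bar>U\<bar> / \<bar>U / 2\<bar>\<close>.\<close>

lemma doubling_constant_le:
  fixes U V :: "(real ^ 'n) set"
  assumes U: "symmetric_convex_body U" and V: "symmetric_convex_body V" and eta: "0 < \<eta>"
    and UV: "\<And>u. u \<in> U \<Longrightarrow> (1 / \<eta>) *\<^sub>R u \<in> V"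
  shows "doubling_constant U V \<le> ereal (2 ^ CARD('n) * (1 + \<eta>) ^ CARD('n))"
  unfolding doubling_constant_def
proof (rule SUP_least)
  fix f :: "real ^ 'n \<Rightarrow> real"
  assume "f \<in> {f. double_positive_definite f \<and> f \<noteq> (\<lambda>x. 0)}"
  then have f: "double_positive_definite f" by simp
  note cont = continuous_on_subset[OF double_positive_definite_continuous[OF f] subset_UNIV]
  note nonneg = double_positive_definite_nonneg[OF f]
  note U' = symmetric_convex_bodyD[OF U] and V' = symmetric_convex_bodyD[OF V]
  define A where "A = (*\<^sub>R) (1 / 2) ` U"
  define W where "W = (*\<^sub>R) (1 + \<eta>) ` V"
  define IU where "IU = (LINT x:U|lborel. f x)"
  define IV where "IV = (LINT x:V|lborel. f x)"
  have AW: "compact A" "compact W"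
    unfolding A_def W_def using U'(1) V'(1) by (auto intro: compact_scaling)
  have AU: "s - t \<in> U" if "s \<in> A" "t \<in> A" for s t
  proof -
    from that obtain u v where uv: "u \<in> U" "v \<in> U" "s = (1 / 2) *\<^sub>R u" "t = (1 / 2) *\<^sub>R v"
      unfolding A_def by blast
    have "(1 / 2) *\<^sub>R u + (1 / 2) *\<^sub>R (- v) \<in> U"
      using U'(2) uv(1) U'(3)[OF uv(2)] by (rule convexD) auto
    then show ?thesis by (simp add: uv)
  qed
  have VW: "v + (s - t) \<in> W" if "v \<in> V" "s \<in> A" "t \<in> A" for v s t
    unfolding W_def using V'(2) that(1) UV[OF AU[OF that(2,3)]] eta by (rule convex_add_scaled)
  have I: "0 \<le> IU" "0 \<le> IV"
    using nonneg by (simp_all add: IU_def IV_def set_lebesgue_integral_def)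
  have "emeasure lborel A * (\<integral>\<^sup>+x\<in>V. f x \<partial>lborel) \<le> emeasure lborel W * (\<integral>\<^sup>+x\<in>U. f x \<partial>lborel)"
    using AW U'(1) V'(1) emeasure_compact_finite[OF AW(1)]
    by (intro double_positive_definite_nn_integral_le[OF f] AU VW) (auto simp: compact_imp_closed)
  then have "measure lborel A * IV \<le> measure lborel W * IU"
    using I AW[THEN compact_fmeasurable_lborel] unfolding IU_def IV_def
    by (simp add: set_nn_integral_compact_eq_integral U' V' cont nonneg emeasure_eq_measure2
        ennreal_mult[symmetric])
  then have le: "(1 / 2) ^ CARD('n) * measure lborel U * IV \<le> (1 + \<eta>) ^ CARD('n) * measure lborel V * IU"
    unfolding A_def W_def using eta by (simp add: measure_lborel_scaleR_image U' V' mult.assoc)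
  have pos: "0 < measure lborel U" "0 < measure lborel V"
    using U V by (auto intro: measure_symmetric_convex_body_pos)
  have "average V f / average U f \<le> 2 ^ CARD('n) * (1 + \<eta>) ^ CARD('n)"
  proof (cases "IU = 0")
    case True
    then show ?thesis using eta by (simp add: average_def IU_def)
  next
    case False
    then have IU: "0 < IU" using I by simp
    have "average V f / average U f = (measure lborel U * IV) / (measure lborel V * IU)"
      by (simp add: average_def IU_def IV_def field_simps)
    also have "\<dots> \<le> 2 ^ CARD('n) * (1 + \<eta>) ^ CARD('n)"
      using le pos IU by (simp add: divide_le_eq power_one_over field_simps)
    finally show ?thesis .
  qed
  then show "ereal (average V f / average U f) \<le> ereal (2 ^ CARD('n) * (1 + \<eta>) ^ CARD('n))"
    by simp
qed

section \<open>Positive definite functions with peaks at lattice points\<close>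

text \<open>Multiplying \<open>f\<close> by a character \<open>cis (w x)\<close> only rotates the coefficients of the quadratic form, and
the cosine is the mean of two characters.\<close>

lemma positive_definite_mult_cos:
  fixes w :: "real ^ 'n \<Rightarrow> real"
  assumes f: "positive_definite f" and w: "linear w"
  shows "positive_definite (\<lambda>x. f x * complex_of_real (cos (w x)))"
  unfolding positive_definite_def
proof (intro conjI allI impI)
  have "continuous_on UNIV w"
    using w by (simp add: linear_continuous_on linear_linear)
  then show "continuous_on UNIV (\<lambda>x. f x * complex_of_real (cos (w x)))"
    using f by (auto simp: positive_definite_def intro!: continuous_intros)
next
  fix Y :: "(real ^ 'n) set" and c :: "real ^ 'n \<Rightarrow> complex"
  assume Y: "finite Y"
  have cos: "complex_of_real (cos (w (a - b))) =
      (cis (w a) * cnj (cis (w b)) + cis (- w a) * cnj (cis (- w b))) / 2" for a b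
    by (simp add: linear_diff[OF w] complex_eq_iff cos_diff sin_diff)
  have "(\<Sum>a\<in>Y. \<Sum>b\<in>Y. c a * cnj (c b) * (f (a - b) * complex_of_real (cos (w (a - b))))) =
      ((\<Sum>a\<in>Y. \<Sum>b\<in>Y. (c a * cis (w a)) * cnj (c b * cis (w b)) * f (a - b)) +
       (\<Sum>a\<in>Y. \<Sum>b\<in>Y. (c a * cis (- w a)) * cnj (c b * cis (- w b)) * f (a - b))) / 2"
    unfolding cos sum.distrib[symmetric] sum_divide_distrib
    by (intro sum.cong refl) (simp add: field_simps)
  also have "\<dots> \<in> \<real>\<^sub>\<ge>\<^sub>0"
  proof -
    have P: "(\<Sum>a\<in>Y. \<Sum>b\<in>Y. d a * cnj (d b) * f (a - b)) \<in> \<real>\<^sub>\<ge>\<^sub>0" for d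
      using f Y by (simp add: positive_definite_def)
    show ?thesis
      using P[of "\<lambda>a. c a * cis (w a)"] P[of "\<lambda>a. c a * cis (- w a)"]
      by (intro nonneg_Reals_divide_I nonneg_Reals_add_I) auto
  qed
  finally show "(\<Sum>a\<in>Y. \<Sum>b\<in>Y. c a * cnj (c b) * (f (a - b) * complex_of_real (cos (w (a - b))))) \<in> \<real>\<^sub>\<ge>\<^sub>0" .
qed

lemma positive_definite_const:
  assumes "0 \<le> r"
  shows "positive_definite (\<lambda>x. complex_of_real r)"
  unfolding positive_definite_def
proof (intro conjI allI impI)
  fix Y :: "(real ^ 'n) set" and c :: "real ^ 'n \<Rightarrow> complex"
  have "(\<Sum>a\<in>Y. \<Sum>b\<in>Y. c a * cnj (c b) * complex_of_real r) = sum c Y * cnj (sum c Y) * complex_of_real r"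
    by (simp add: sum_distrib_left sum_distrib_right) (subst sum.swap, simp)
  also have "\<dots> = complex_of_real ((cmod (sum c Y))\<^sup>2 * r)"
    unfolding of_real_mult complex_norm_square ..
  also have "\<dots> \<in> \<real>\<^sub>\<ge>\<^sub>0" using assms by simp
  finally show "(\<Sum>a\<in>Y. \<Sum>b\<in>Y. c a * cnj (c b) * complex_of_real r) \<in> \<real>\<^sub>\<ge>\<^sub>0" .
qed simp

lemma positive_definite_add:
  assumes "positive_definite f" "positive_definite g"
  shows "positive_definite (\<lambda>x. f x + g x)"
  using assms unfolding positive_definite_def
  by (auto simp: algebra_simps sum.distrib intro!: continuous_intros nonneg_Reals_add_I)

lemma positive_definite_scale:
  assumes "positive_definite f" "0 \<le> r"
  shows "positive_definite (\<lambda>x. complex_of_real r * f x)"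
  unfolding positive_definite_def
proof (intro conjI allI impI)
  show "continuous_on UNIV (\<lambda>x. complex_of_real r * f x)"
    using assms by (auto simp: positive_definite_def intro!: continuous_intros)
  fix Y :: "(real ^ 'a) set" and c :: "real ^ 'a \<Rightarrow> complex"
  assume Y: "finite Y"
  have "(\<Sum>a\<in>Y. \<Sum>b\<in>Y. c a * cnj (c b) * (complex_of_real r * f (a - b))) =
      complex_of_real r * (\<Sum>a\<in>Y. \<Sum>b\<in>Y. c a * cnj (c b) * f (a - b))"
    by (simp add: sum_distrib_left mult_ac)
  also have "\<dots> \<in> \<real>\<^sub>\<ge>\<^sub>0"
    using assms Y by (intro nonneg_Reals_mult_I) (auto simp: positive_definite_def)
  finally show "(\<Sum>a\<in>Y. \<Sum>b\<in>Y. c a * cnj (c b) * (complex_of_real r * f (a - b))) \<in> \<real>\<^sub>\<ge>\<^sub>0" .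
qed

lemma positive_definite_sum:
  assumes "finite I" "\<And>i. i \<in> I \<Longrightarrow> positive_definite (f i)"
  shows "positive_definite (\<lambda>x. \<Sum>i\<in>I. f i x)"
  using assms
proof (induction I rule: finite_induct)
  case empty
  then show ?case using positive_definite_const[of 0] by simp
next
  case (insert i I)
  then show ?case by (simp add: positive_definite_add)
qed

text \<open>The affine rescaling puts the values into \<open>[0, 1]\<close>. The value \<open>1\<close> is reached exactly where all
the phases \<open>w i x\<close> are multiples of \<open>2 * pi\<close>, so its high powers concentrate there.\<close>

definition cosine_peak :: "('i::finite \<Rightarrow> real ^ 'n \<Rightarrow> real) \<Rightarrow> real ^ 'n \<Rightarrow> real" where
  "cosine_peak w x = (1 + (\<Sum>i\<in>UNIV. cos (w i x)) / CARD('i)) / 2"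

lemma cosine_peak_eq_sum: "cosine_peak w x = (\<Sum>i\<in>UNIV. (1 + cos (w i x)) / (2 * CARD('i)))"
  for w :: "'i::finite \<Rightarrow> real ^ 'n \<Rightarrow> real"
  by (simp add: cosine_peak_def sum_divide_distrib[symmetric] sum.distrib field_simps)

lemma cosine_peak_nonneg: "0 \<le> cosine_peak w x"
  unfolding cosine_peak_eq_sum
proof (rule sum_nonneg)
  fix i show "0 \<le> (1 + cos (w i x)) / real (2 * CARD('a))" using cos_ge_minus_one[of "w i x"] by (intro divide_nonneg_nonneg) linarith+
qed

lemma cosine_peak_le_1: "cosine_peak w x \<le> 1"
proof -
  have "(\<Sum>i\<in>UNIV. cos (w i x)) \<le> (\<Sum>i\<in>(UNIV :: 'a set). 1)" by (intro sum_mono) simp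
  then show ?thesis by (simp add: cosine_peak_def field_simps)
qed

lemma cosine_peak_eq_1_iff: "cosine_peak w x = 1 \<longleftrightarrow> (\<forall>i. cos (w i x) = 1)"
  for w :: "'i::finite \<Rightarrow> real ^ 'n \<Rightarrow> real"
proof -
  have "cosine_peak w x = 1 \<longleftrightarrow> (\<Sum>i\<in>UNIV. 1 - cos (w i x)) = 0"
    by (auto simp add: cosine_peak_def sum_subtractf field_simps)
  also have "\<dots> \<longleftrightarrow> (\<forall>i. cos (w i x) = 1)"
    by (subst sum_nonneg_eq_0_iff) auto
  finally show ?thesis .
qed

text \<open>One more factor multiplies by a combination of \<open>1\<close> and cosines with nonnegative coefficients;
this avoids the general fact that products of positive definite functions are positive definite.\<close>

lemma double_positive_definite_cosine_peak_power:
  fixes w :: "'i::finite \<Rightarrow> real ^ 'n \<Rightarrow> real"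
  assumes w: "\<And>i. linear (w i)"
  shows "double_positive_definite (\<lambda>x. cosine_peak w x ^ k)"
proof -
  have "positive_definite (\<lambda>x. complex_of_real (cosine_peak w x ^ k))"
  proof (induction k)
    case 0
    then show ?case using positive_definite_const[of 1] by simp
  next
    case (Suc k)
    let ?f = "\<lambda>x. complex_of_real (cosine_peak w x ^ k)"
    let ?r = "1 / (2 * real CARD('i))"
    have "positive_definite (\<lambda>x. \<Sum>i\<in>UNIV. complex_of_real ?r * (?f x + ?f x * complex_of_real (cos (w i x))))"
      by (intro positive_definite_sum positive_definite_scale positive_definite_add
          positive_definite_mult_cos Suc w) auto
    also have "(\<lambda>x. \<Sum>i\<in>UNIV. complex_of_real ?r * (?f x + ?f x * complex_of_real (cos (w i x)))) =
        (\<lambda>x. complex_of_real (cosine_peak w x ^ Suc k))"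
    proof
      fix x
      have "cosine_peak w x ^ Suc k = (\<Sum>i\<in>UNIV. ?r * (cosine_peak w x ^ k + cosine_peak w x ^ k * cos (w i x)))"
        by (subst power_Suc, subst (1) cosine_peak_eq_sum)
          (simp add: sum_distrib_left field_simps)
      then show "(\<Sum>i\<in>UNIV. complex_of_real ?r * (?f x + ?f x * complex_of_real (cos (w i x)))) =
          complex_of_real (cosine_peak w x ^ Suc k)" by simp
    qed
    finally show ?case .
  qed
  then show ?thesis by (simp add: double_positive_definite_def cosine_peak_nonneg)
qed

text \<open>The phases are \<open>2 * pi\<close> times the coordinates with respect to the lattice basis, so that
they are all multiples of \<open>2 * pi\<close> precisely at the lattice points.\<close>

lemma lattice_peak_function:
  fixes L :: "(real ^ 'n) set"
  assumes "is_lattice L"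
  obtains g :: "real ^ 'n \<Rightarrow> real"
  where "continuous_on UNIV g" "\<And>x. 0 \<le> g x" "\<And>x. g x \<le> 1" "\<And>x. g x = 1 \<longleftrightarrow> x \<in> L"
    "\<And>x l. l \<in> L \<Longrightarrow> g (x + l) = g x" "\<And>k. double_positive_definite (\<lambda>x. g x ^ k)"
proof -
  obtain M :: "real ^ 'n ^ 'n" where M: "det M \<noteq> 0" "L = (\<lambda>z. M *v z) ` {z. \<forall>i. z $ i \<in> \<int>}"
    using assms by (auto simp: is_lattice_def)
  obtain N where N: "N ** M = mat 1" "M ** N = mat 1"
    using M(1) by (auto simp: invertible_det_nz[symmetric] invertible_def)
  have NM: "N *v (M *v z) = z" and MN: "M *v (N *v x) = x" for z x
    by (simp_all add: N matrix_vector_mul_assoc)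
  define w where "w i x = 2 * pi * (N *v x) $ i" for i x
  have w: "linear (w i)" for i
    unfolding w_def by (intro linearI) (simp_all add: matrix_vector_right_distrib algebra_simps)
  have L: "x \<in> L \<longleftrightarrow> (\<forall>i. (N *v x) $ i \<in> \<int>)" for x
    unfolding M(2) using NM MN by (auto simp: image_iff)
  show thesis
  proof
    have "continuous_on UNIV (w i)" for i
      using w by (simp add: linear_continuous_on linear_linear)
    then show "continuous_on UNIV (cosine_peak w)"
      unfolding cosine_peak_def by (intro continuous_intros) auto
    show "cosine_peak w x = 1 \<longleftrightarrow> x \<in> L" for x
      unfolding cosine_peak_eq_1_iff L w_def
      by (auto simp: cos_one_2pi_int cos_integer_2pi Ints_def image_iff)
    show "cosine_peak w (x + l) = cosine_peak w x" if "l \<in> L" for x l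
    proof -
      have "cos (w i (x + l)) = cos (w i x)" for i
      proof -
        have "(N *v l) $ i \<in> \<int>" using that L by blast
        then have "cos (w i l) = 1" "sin (w i l) = 0"
          unfolding w_def by (rule cos_integer_2pi sin_integer_2pi)+
        then show ?thesis by (simp add: linear_add[OF w] cos_add)
      qed
      then show ?thesis by (simp add: cosine_peak_def)
    qed
  qed (simp_all add: cosine_peak_nonneg cosine_peak_le_1 double_positive_definite_cosine_peak_power w)
qed

section \<open>The lower bound\<close>

lemma set_integral_compact_mono:
  fixes f :: "'a::euclidean_space \<Rightarrow> real"
  assumes "compact A" "compact B" "A \<subseteq> B" "continuous_on UNIV f" "\<And>x. 0 \<le> f x"
  shows "(LINT x:A|lborel. f x) \<le> (LINT x:B|lborel. f x)"
  unfolding set_lebesgue_integral_def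
proof (rule integral_mono)
  have "integrable lborel (\<lambda>x. indicator C x *\<^sub>R f x)" if "C \<in> {A, B}" for C
    using assms(1,2) that by (intro borel_integrable_compact continuous_on_subset[OF assms(4)]) auto
  then show "integrable lborel (\<lambda>x. indicator A x *\<^sub>R f x)"
    "integrable lborel (\<lambda>x. indicator B x *\<^sub>R f x)" by auto
  show "indicator A x *\<^sub>R f x \<le> indicator B x *\<^sub>R f x" for x
    using assms(3,5) by (auto simp: indicator_def)
qed

lemma sum_translates_le_set_integral:
  fixes f :: "real ^ 'n \<Rightarrow> real"
  assumes fin: "finite S" and B: "compact B" and V: "compact V"
    and cont: "continuous_on UNIV f" and nonneg: "\<And>x. 0 \<le> f x"
    and per: "\<And>l x. l \<in> S \<Longrightarrow> f (x + l) = f x"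
    and sub: "\<And>l x. l \<in> S \<Longrightarrow> x \<in> B \<Longrightarrow> l + x \<in> V"
    and disj: "\<And>l l' x y. l \<in> S \<Longrightarrow> l' \<in> S \<Longrightarrow> x \<in> B \<Longrightarrow> y \<in> B \<Longrightarrow> l + x = l' + y \<Longrightarrow> l = l'"
  shows "real (card S) * (LINT x:B|lborel. f x) \<le> (LINT x:V|lborel. f x)"
proof -
  have trans_compact: "compact ((+) l ` B)" for l using B by (rule compact_translation)
  have shift: "(LINT x:(+) l ` B|lborel. f x) = (LINT x:B|lborel. f x)" if l: "l \<in> S" for l
  proof -
    have "(LINT x:(+) l ` B|lborel. f x) = (\<integral>x. indicator ((+) l ` B) x *\<^sub>R f x \<partial>distr lborel borel ((+) l))"
      by (simp add: set_lebesgue_integral_def lborel_distr_plus)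
    also have "\<dots> = (\<integral>x. indicator ((+) l ` B) (l + x) *\<^sub>R f (l + x) \<partial>lborel)"
    proof (rule integral_distr)
      show "(\<lambda>x. indicator ((+) l ` B) x *\<^sub>R f x) \<in> borel_measurable borel"
        using trans_compact[of l]
        by (intro borel_measurable_continuous_on_indicator continuous_on_subset[OF cont])
          (auto intro: borel_compact)
    qed simp
    also have "\<dots> = (LINT x:B|lborel. f x)"
      unfolding set_lebesgue_integral_def
      by (intro Bochner_Integration.integral_cong refl)
        (auto simp: indicator_def per[OF l, simplified add.commute])
    finally show ?thesis .
  qed
  have int: "set_integrable lborel C f" if "compact C" for C
    unfolding set_integrable_def using that
    by (intro borel_integrable_compact continuous_on_subset[OF cont]) auto
  have "real (card S) * (LINT x:B|lborel. f x) = (\<Sum>l\<in>S. LINT x:(+) l ` B|lborel. f x)"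
    by (simp add: shift)
  also have "\<dots> = (LINT x:(\<Union>l\<in>S. (+) l ` B)|lborel. f x)"
    using trans_compact int fin
    by (intro set_integral_finite_Union[symmetric])
       (auto simp: disjoint_family_on_def compact_imp_closed dest: disj)
  also have "\<dots> \<le> (LINT x:V|lborel. f x)"
    using V trans_compact fin cont nonneg sub
    by (intro set_integral_compact_mono compact_UN) auto
  finally show ?thesis .
qed

text \<open>The counted translates of \<open>P\<close> cover \<open>(1 - \<eta>) V\<close>: if \<open>x \<in> (1 - \<eta>) V\<close> lies in \<open>l + P\<close>, then
\<open>l + U\<close> is contained in \<open>x + 2 U\<close>, hence in \<open>(1 - \<eta>) V + \<eta> V = V\<close>.\<close>

lemma count_translates_ge:
  fixes P V :: "(real ^ 'n) set"
  assumes U: "symmetric_convex_body U" and V: "symmetric_convex_body V"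
    and P: "compact P" "P \<subseteq> U"
    and cov: "\<And>x. \<exists>p\<in>P. \<exists>l\<in>L. x = p + l"
    and eta: "0 < \<eta>" "\<eta> < 1" and UV: "\<And>u. u \<in> U \<Longrightarrow> (2 / \<eta>) *\<^sub>R u \<in> V"
    and fin: "finite {l \<in> L. \<forall>u\<in>U. l + u \<in> V}"
  shows "(1 - \<eta>) ^ CARD('n) * measure lborel V \<le> card {l \<in> L. \<forall>u\<in>U. l + u \<in> V} * measure lborel P"
proof -
  let ?S = "{l \<in> L. \<forall>u\<in>U. l + u \<in> V}"
  note U' = symmetric_convex_bodyD[OF U] and V' = symmetric_convex_bodyD[OF V]
  have cP: "compact ((+) l ` P)" for l using P(1) by (rule compact_translation)
  have sub: "(*\<^sub>R) (1 - \<eta>) ` V \<subseteq> (\<Union>l\<in>?S. (+) l ` P)"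
  proof
    fix x assume "x \<in> (*\<^sub>R) (1 - \<eta>) ` V"
    then obtain v where v: "v \<in> V" "x = (1 - \<eta>) *\<^sub>R v" by blast
    obtain p l where pl: "p \<in> P" "l \<in> L" "x = p + l" using cov by blast
    have "l + u \<in> V" if u: "u \<in> U" for u
    proof -
      have "(1 / 2) *\<^sub>R u + (1 / 2) *\<^sub>R (- p) \<in> U"
        using U'(2) u U'(3) pl(1) P(2) by (intro convexD) auto
      from UV[OF this] have "(1 / \<eta>) *\<^sub>R (u - p) \<in> V"
        using eta by (simp add: scaleR_add_right scaleR_diff_right)
      then have "(1 - \<eta>) *\<^sub>R v + \<eta> *\<^sub>R ((1 / \<eta>) *\<^sub>R (u - p)) \<in> V"
        using V'(2) v(1) eta by (intro convexD) auto
      moreover have "(1 - \<eta>) *\<^sub>R v + \<eta> *\<^sub>R ((1 / \<eta>) *\<^sub>R (u - p)) = l + u"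
        using v(2) pl(3) eta by (simp add: algebra_simps)
      ultimately show ?thesis by simp
    qed
    with pl show "x \<in> (\<Union>l\<in>?S. (+) l ` P)" by (auto simp: add.commute)
  qed
  have "(1 - \<eta>) ^ CARD('n) * measure lborel V = measure lborel ((*\<^sub>R) (1 - \<eta>) ` V)"
    using eta V'(1) by (simp add: measure_lborel_scaleR_image)
  also have "\<dots> \<le> measure lborel (\<Union>l\<in>?S. (+) l ` P)"
  proof (rule measure_mono_fmeasurable[OF sub])
    show "(*\<^sub>R) (1 - \<eta>) ` V \<in> sets lborel"
      using V'(1) by (auto intro!: borel_compact compact_scaling)
    show "(\<Union>l\<in>?S. (+) l ` P) \<in> fmeasurable lborel"
      using fin cP by (intro compact_fmeasurable_lborel compact_UN) auto
  qed
  also have "\<dots> \<le> (\<Sum>l\<in>?S. measure lborel ((+) l ` P))"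
    using fin cP by (intro measure_UNION_le) (auto intro!: borel_compact)
  also have "\<dots> = card ?S * measure lborel P"
    using P(1) by (simp add: measure_lborel_translation_image)
  finally show ?thesis .
qed

text \<open>The test functions are the powers \<open>g ^ k\<close> of the lattice peak function. In \<open>U\<close> the only peak is
at \<open>0\<close>, and away from it \<open>g \<le> q < 1\<close>; so the integral over \<open>U\<close> is, up to a factor tending to \<open>1\<close>,
the integral over a small ball \<open>B\<close> around \<open>0\<close>. The body \<open>V\<close> contains disjoint translates of \<open>B\<close>
around at least \<open>(1 - \<eta>) ^ n * \<bar>V\<bar> / \<bar>P\<bar>\<close> lattice points, each with the same integral by periodicity.\<close>

lemma doubling_constant_ge:
  fixes U V P L :: "(real ^ 'n) set"
  assumes U: "symmetric_convex_body U" and V: "symmetric_convex_body V"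
    and L: "is_lattice L" and LU: "L \<inter> U \<subseteq> {0}"
    and P: "compact P" "P \<subseteq> U" and cov: "\<And>x. \<exists>p\<in>P. \<exists>l\<in>L. x = p + l"
    and eta: "0 < \<eta>" "\<eta> < 1" and UV: "\<And>u. u \<in> U \<Longrightarrow> (2 / \<eta>) *\<^sub>R u \<in> V"
  shows "ereal ((1 - \<eta>) ^ CARD('n) * measure lborel U / measure lborel P) \<le> doubling_constant U V"
proof -
  note U' = symmetric_convex_bodyD[OF U] and V' = symmetric_convex_bodyD[OF V]
  obtain g :: "real ^ 'n \<Rightarrow> real" where g: "continuous_on UNIV g" "\<And>x. 0 \<le> g x" "\<And>x. g x \<le> 1"
    and g1: "\<And>x. g x = 1 \<longleftrightarrow> x \<in> L" and per: "\<And>x l. l \<in> L \<Longrightarrow> g (x + l) = g x"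
    and pd: "\<And>k. double_positive_definite (\<lambda>x. g x ^ k)"
    by (rule lattice_peak_function[OF L]) (rule that)
  have diffL: "a - b \<in> L" if "a \<in> L" "b \<in> L" for a b
    using per[OF that(2), of "a - b"] that g1[of a] g1[of "a - b"] by simp
  have zeroL: "0 \<in> L"
    using cov diffL by force
  obtain e where e: "e > 0" "cball 0 e \<subseteq> U"
    using symmetric_convex_body_contains_ball[OF U] .
  \<comment> \<open>Distinct lattice points have distance greater than \<open>e\<close>, so balls of radius \<open>e / 2\<close> around them
    are disjoint.\<close>
  define r where "r = e / 2"
  define B where "B = cball (0 :: real ^ 'n) r"
  have r: "r > 0" "B \<subseteq> U" "compact B" using e by (auto simp: r_def B_def subset_iff)
  have sep: "a = b" if "a \<in> L" "b \<in> L" "dist a b \<le> e" for a b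
    using diffL[OF that(1,2)] that(3) e LU by (force simp: dist_norm)
  obtain q where q: "0 \<le> q" "q < 1" "\<And>x. x \<in> U - ball 0 r \<Longrightarrow> g x \<le> q"
  proof (cases "U - ball 0 r = {}")
    case True
    then show thesis by (intro that[of 0]) auto
  next
    case False
    have "compact (U - ball 0 r)" using U'(1) by (simp add: compact_diff)
    from continuous_attains_sup[OF this False continuous_on_subset[OF g(1)]]
    obtain x where x: "x \<in> U - ball 0 r" "\<And>y. y \<in> U - ball 0 r \<Longrightarrow> g y \<le> g x" by auto
    have "x \<notin> L" using x(1) LU r(1) by auto
    then have "g x \<noteq> 1" using g1 by simp
    with g(3)[of x] have "g x < 1" by simp
    with g(2)[of x] x(2) show thesis by (intro that[of "g x"]) auto
  qed
  \<comment> \<open>Any level strictly between \<open>q\<close> and the peak value \<open>1\<close> serves: the powers \<open>q ^ k\<close> off the peak become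
    negligible against \<open>q' ^ k\<close> near it.\<close>
  define q' where "q' = (1 + q) / 2"
  have q': "q < q'" "q' < 1" "0 < q'" using q by (auto simp: q'_def)
  obtain \<rho> where rho: "0 < \<rho>" "\<rho> \<le> r" "\<And>x. x \<in> cball 0 \<rho> \<Longrightarrow> q' \<le> g x"
  proof -
    have "isCont g 0" using g(1) by (simp add: continuous_on_eq_continuous_at)
    moreover have "q' < g 0" using g1[of 0] zeroL q' by simp
    ultimately have "eventually (\<lambda>x. q' < g x) (nhds 0)"
      using order_tendstoD(1) unfolding isCont_def tendsto_at_iff_tendsto_nhds by fastforce
    then obtain d where d: "d > 0" "\<And>x. dist x 0 < d \<Longrightarrow> q' < g x"
      by (auto simp: eventually_nhds_metric)
    show thesis
    proof (rule that[of "min r (d / 2)"])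
      fix x :: "real ^ 'n" assume "x \<in> cball 0 (min r (d / 2))"
      then have "dist x 0 < d" using d(1) by auto
      then show "q' \<le> g x" using d(2) by force
    qed (use r d in auto)
  qed
  define S where "S = {l \<in> L. \<forall>u\<in>U. l + u \<in> V}"
  have zeroU: "0 \<in> U" using e by auto
  have finS: "finite S"
  proof -
    have "S \<subseteq> V"
    proof
      fix l assume "l \<in> S"
      then have "l + 0 \<in> V" using zeroU unfolding S_def by blast
      then show "l \<in> V" by simp
    qed
    then have "bounded S" using V'(1) compact_imp_bounded bounded_subset by blast
    moreover have "uniform_discrete S"
      unfolding uniform_discrete_def using sep e(1)
      by (intro exI[of _ e]) (auto simp: S_def intro: less_imp_le)
    ultimately show ?thesis using uniform_discrete_finite_iff by blast
  qed
  define I where "I k = (LINT x:B|lborel. g x ^ k)" for k :: nat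
  define b where "b = measure lborel (cball (0 :: real ^ 'n) \<rho>)"
  define a where "a = (1 - \<eta>) ^ CARD('n) * measure lborel U / measure lborel P"
  \<comment> \<open>An upper bound for the ratio of the integral of \<open>g ^ k\<close> over \<open>U\<close> outside \<open>B\<close> to the one over \<open>B\<close>.\<close>
  define t where "t k = measure lborel U / b * (q / q') ^ k" for k :: nat
  have b: "b > 0" using rho(1) by (simp add: b_def)
  have pos: "0 < measure lborel U" "0 < measure lborel V"
    using U V by (auto intro: measure_symmetric_convex_body_pos)
  have count: "(1 - \<eta>) ^ CARD('n) * measure lborel V \<le> card S * measure lborel P"
    unfolding S_def using count_translates_ge[OF U V P cov eta UV] finS by (simp add: S_def)
  have P_pos: "0 < measure lborel P"
  proof (rule ccontr)
    assume "\<not> 0 < measure lborel P"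
    then have "measure lborel P = 0" using measure_nonneg[of lborel P] by simp
    then have "(1 - \<eta>) ^ CARD('n) * measure lborel V \<le> 0" using count by simp
    moreover have "0 < (1 - \<eta>) ^ CARD('n) * measure lborel V" using pos eta by simp
    ultimately show False by simp
  qed
  have int: "set_integrable lborel C f" if "compact C" "continuous_on UNIV f"
    for C and f :: "real ^ 'n \<Rightarrow> real"
    unfolding set_integrable_def using that
    by (intro borel_integrable_compact continuous_on_subset[OF that(2)]) auto
  have gk: "continuous_on UNIV (\<lambda>x. g x ^ k)" for k using g(1) by (intro continuous_intros)
  have measure_mult_eq: "measure lborel C * c = (LINT x:C|lborel. c)" if "compact C" for C :: "(real ^ 'n) set" and c :: real
    using that emeasure_compact_finite[OF that]
    by (subst set_integral_const) (auto simp: compact_imp_closed)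
  have I_ge: "b * q' ^ k \<le> I k" for k
  proof -
    have "b * q' ^ k = (LINT x:cball (0 :: real ^ 'n) \<rho>|lborel. q' ^ k)"
      unfolding b_def by (rule measure_mult_eq) simp
    also have "\<dots> \<le> (LINT x:cball 0 \<rho>|lborel. g x ^ k)"
      using q' rho(3) by (intro set_integral_mono int gk power_mono) auto
    also have "\<dots> \<le> I k"
      unfolding I_def using r(3) rho(2) g(2)
      by (intro set_integral_compact_mono gk) (auto simp: B_def)
    finally show ?thesis .
  qed
  have I_pos: "0 < I k" for k
    using I_ge[of k] b q' by (smt (verit) mult_pos_pos zero_less_power)
  have avg: "a / (1 + t k) \<le> average V (\<lambda>x. g x ^ k) / average U (\<lambda>x. g x ^ k)" for k
  proof -
    let ?IU = "LINT x:U|lborel. g x ^ k" and ?IV = "LINT x:V|lborel. g x ^ k"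
    have IV: "card S * I k \<le> ?IV"
      unfolding I_def
    proof (rule sum_translates_le_set_integral[OF finS r(3) V'(1) gk])
      show "l + x \<in> V" if "l \<in> S" "x \<in> B" for l x
        using that r(2) by (auto simp: S_def)
      show "l = l'" if "l \<in> S" "l' \<in> S" "x \<in> B" "y \<in> B" "l + x = l' + y" for l l' x y
      proof (rule sep)
        have "l - l' = y - x" using that(5) by (simp add: algebra_simps)
        then have "dist l l' \<le> norm y + norm x" by (simp add: dist_norm norm_triangle_ineq4)
        then show "dist l l' \<le> e" using that(3,4) by (simp add: B_def r_def)
      qed (use that in \<open>auto simp: S_def\<close>)
    qed (use g(2) per in \<open>auto simp: S_def\<close>)
    note intU = int[OF U'(1) gk[of k], unfolded set_integrable_def]
      and intB = int[OF r(3) gk[of k], unfolded set_integrable_def]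
      and intq = int[OF U'(1) continuous_on_const[of UNIV "q ^ k"], unfolded set_integrable_def]
    have "?IU \<le> (\<integral>x. indicator B x *\<^sub>R g x ^ k + indicator U x *\<^sub>R q ^ k \<partial>lborel)"
      unfolding set_lebesgue_integral_def
    proof (rule integral_mono)
      fix x
      show "indicator U x *\<^sub>R g x ^ k \<le> indicator B x *\<^sub>R g x ^ k + indicator U x *\<^sub>R q ^ k"
      proof (cases "x \<in> U - ball 0 r")
        case True
        then have "g x ^ k \<le> q ^ k" using q(3) g(2) by (intro power_mono)
        then show ?thesis using g(2)[of x] q(1) True by (simp add: indicator_def)
      next
        case False
        then show ?thesis using q(1) g(2)[of x] by (auto simp: indicator_def B_def)
      qed
    qed (use intU intB intq in \<open>auto intro: Bochner_Integration.integrable_add\<close>)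
    also have "\<dots> = I k + measure lborel U * q ^ k"
      using Bochner_Integration.integral_add[OF intB intq]
      unfolding I_def measure_mult_eq[OF U'(1)] set_lebesgue_integral_def .
    also have "measure lborel U * q ^ k = b * q' ^ k * t k"
      using b q' by (simp add: t_def power_divide)
    also have "\<dots> \<le> I k * t k"
      using I_ge b q q' pos by (intro mult_right_mono) (auto simp: t_def)
    finally have IU: "?IU \<le> I k * (1 + t k)" by (simp add: algebra_simps)
    have "I k \<le> ?IU"
      unfolding I_def using r U'(1) g(2)
      by (intro set_integral_compact_mono gk) auto
    then have IU_pos: "0 < ?IU" using I_pos[of k] by simp
    have t: "0 \<le> t k" using b q q' pos by (simp add: t_def)
    have "a * measure lborel V \<le> card S * measure lborel U"
      using mult_right_mono[OF count, of "measure lborel U"] pos P_pos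
      by (simp add: a_def field_simps)
    then have "a * measure lborel V * ?IU \<le> card S * measure lborel U * (I k * (1 + t k))"
      by (rule mult_mono) (use IU IU_pos pos in auto)
    also have "\<dots> = (card S * I k) * (measure lborel U * (1 + t k))" by simp
    also have "\<dots> \<le> ?IV * (measure lborel U * (1 + t k))"
      using IV t pos by (intro mult_right_mono) auto
    finally show ?thesis
      using IU_pos pos t by (simp add: average_def field_simps)
  qed
  have "(\<lambda>k. a / (1 + t k)) \<longlonglongrightarrow> a / (1 + measure lborel U / b * 0)"
    unfolding t_def using q q' by (intro tendsto_intros LIMSEQ_realpow_zero) auto
  then have lim: "(\<lambda>k. ereal (a / (1 + t k))) \<longlonglongrightarrow> ereal a" by simp
  have "ereal (a / (1 + t k)) \<le> doubling_constant U V" for k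
  proof -
    have "g 0 ^ k \<noteq> 0" using g1[of 0] zeroL by simp
    then have "(\<lambda>x. g x ^ k) \<noteq> (\<lambda>x. 0)" by metis
    then have "ereal (average V (\<lambda>x. g x ^ k) / average U (\<lambda>x. g x ^ k)) \<le> doubling_constant U V"
      unfolding doubling_constant_def using pd by (intro SUP_upper) auto
    then show ?thesis using avg[of k] by (meson ereal_less_eq(3) order_trans)
  qed
  then have "ereal a \<le> doubling_constant U V"
    using lim by (intro LIMSEQ_le_const2[OF lim]) auto
  then show ?thesis by (simp add: a_def)
qed

lemma is_lattice_scale:
  fixes L :: "(real ^ 'n) set"
  assumes "is_lattice L" and c: "c \<noteq> 0"
  shows "is_lattice ((*\<^sub>R) c ` L)"
proof -
  obtain M :: "real ^ 'n ^ 'n" where M: "det M \<noteq> 0" "L = (\<lambda>z. M *v z) ` {z. \<forall>i. z $ i \<in> \<int>}"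
    using assms by (auto simp: is_lattice_def)
  have "inj ((*v) M)"
    using M(1) by (simp add: invertible_det_nz[symmetric] invertible_left_inverse
        matrix_left_invertible_injective)
  then have "inj ((*v) (c *\<^sub>R M))"
    using c by (auto simp: inj_def scaleR_matrix_vector_assoc[symmetric])
  then have "det (c *\<^sub>R M) \<noteq> 0"
    by (simp add: invertible_det_nz[symmetric] invertible_left_inverse
        matrix_left_invertible_injective)
  moreover have "(*\<^sub>R) c ` L = (\<lambda>z. (c *\<^sub>R M) *v z) ` {z. \<forall>i. z $ i \<in> \<int>}"
    by (simp add: M(2) image_image scaleR_matrix_vector_assoc)
  ultimately show ?thesis unfolding is_lattice_def by blast
qed

lemma zero_in_lattice: "is_lattice L \<Longrightarrow> 0 \<in> L"
  unfolding is_lattice_def by (auto intro!: image_eqI[of _ _ 0])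

text \<open>If \<open>U + \<Lambda>\<close> is a tiling, so is \<open>U / 2 + \<Lambda> / 2\<close>, and \<open>\<Lambda> / 2\<close> has no nonzero point in the
interior of \<open>U\<close>; but it may have some on the boundary. Scaling by \<open>(1 + \<eta>) / 2\<close> instead
pushes these points out of \<open>U\<close>, at the cost of the factor \<open>(1 + \<eta>) ^ n\<close> in the density.\<close>

lemma doubling_constant_tile_ge:
  fixes U V :: "(real ^ 'n) set"
  assumes tile: "tile U" and V: "symmetric_convex_body V"
    and eta: "0 < \<eta>" "\<eta> < 1" and UV: "\<And>u. u \<in> U \<Longrightarrow> (2 / \<eta>) *\<^sub>R u \<in> V"
  shows "ereal (2 ^ CARD('n) * ((1 - \<eta>) / (1 + \<eta>)) ^ CARD('n)) \<le> doubling_constant U V"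
proof -
  obtain \<Lambda> where U: "symmetric_convex_body U" and \<Lambda>: "is_lattice \<Lambda>"
    and pack: "lattice_packing U \<Lambda>" and cov: "lattice_covering U \<Lambda>"
    using tile by (auto simp: tile_def)
  note U' = symmetric_convex_bodyD[OF U]
  have zero: "0 \<in> interior U" by (rule zero_in_interior_symmetric_convex_body[OF U])
  then have zeroU: "0 \<in> U" using interior_subset by blast
  define c where "c = (1 + \<eta>) / 2"
  have c: "0 < c" "c < 1" "2 * c = 1 + \<eta>" using eta by (auto simp: c_def)
  define P where "P = (*\<^sub>R) c ` U"
  define L where "L = (*\<^sub>R) c ` \<Lambda>"
  have shrink: "s *\<^sub>R u \<in> U" if "u \<in> U" "0 \<le> s" "s \<le> 1" for s u
    using convexD[OF U'(2) that(1) zeroU, of s "1 - s"] that by simp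
  have LU: "L \<inter> U \<subseteq> {0}"
  proof
    fix l assume l: "l \<in> L \<inter> U"
    then obtain a where a: "a \<in> \<Lambda>" "l = c *\<^sub>R a" by (auto simp: L_def)
    \<comment> \<open>If a nonzero \<open>l = c *\<^sub>R a\<close> were in \<open>U\<close>, then \<open>2 *\<^sub>R l \<in> 2 U\<close>, and moving \<open>2 *\<^sub>R l\<close> towards \<open>0\<close> by the factor
      \<open>1 / (1 + \<eta>)\<close> would give the lattice point \<open>a\<close> in the interior of \<open>2 U\<close>, against the packing property.\<close>
    have conv: "convex ((\<lambda>x. 2 *\<^sub>R x) ` U)" using U'(2) by (rule convex_scaling)
    have "U \<subseteq> (\<lambda>x. 2 *\<^sub>R x) ` U"
    proof
      fix u assume "u \<in> U"
      then show "u \<in> (\<lambda>x. 2 *\<^sub>R x) ` U" using shrink[of u "1/2"] by (intro image_eqI[of _ _ "(1/2) *\<^sub>R u"]) auto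
    qed
    then have "0 \<in> interior ((\<lambda>x. 2 *\<^sub>R x) ` U)" using zero interior_mono by blast
    moreover have "2 *\<^sub>R l \<in> (\<lambda>x. 2 *\<^sub>R x) ` U" using l by blast
    ultimately have "2 *\<^sub>R l - (\<eta> / (1 + \<eta>)) *\<^sub>R (2 *\<^sub>R l - 0) \<in> interior ((\<lambda>x. 2 *\<^sub>R x) ` U)"
      using eta by (intro mem_interior_convex_shrink[OF conv]) auto
    also have "2 *\<^sub>R l - (\<eta> / (1 + \<eta>)) *\<^sub>R (2 *\<^sub>R l - 0) = (2 * c - (\<eta> / (1 + \<eta>)) * (2 * c)) *\<^sub>R a"
      by (simp add: a(2) algebra_simps)
    also have "2 * c - (\<eta> / (1 + \<eta>)) * (2 * c) = 1" using c(3) eta by (simp add: field_simps)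
    finally have "a - 0 \<in> interior ((\<lambda>x. 2 *\<^sub>R x) ` U)" by simp
    then have "a = 0"
      using pack a(1) zero_in_lattice[OF \<Lambda>] unfolding lattice_packing_def by blast
    then show "l \<in> {0}" using a(2) by simp
  qed
  have "ereal ((1 - \<eta>) ^ CARD('n) * measure lborel U / measure lborel P) \<le> doubling_constant U V"
  proof (rule doubling_constant_ge[OF U V _ LU _ _ _ eta UV])
    show "is_lattice L" unfolding L_def using \<Lambda> c by (intro is_lattice_scale) auto
    show "compact P" unfolding P_def using U'(1) by (rule compact_scaling)
    show "P \<subseteq> U" unfolding P_def using shrink c by auto
    show "\<exists>p\<in>P. \<exists>l\<in>L. x = p + l" for x
    proof -
      obtain p a where "p \<in> U" "a \<in> \<Lambda>" "(1 / c) *\<^sub>R x = p + a"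
        using cov unfolding lattice_covering_def by blast
      moreover from this(3) have "x = c *\<^sub>R p + c *\<^sub>R a"
        using c by (metis divide_inverse mult.left_neutral scaleR_add_right scaleR_one scaleR_scaleR
            right_inverse less_irrefl)
      ultimately show ?thesis unfolding P_def L_def by blast
    qed
  qed
  also have "(1 - \<eta>) ^ CARD('n) * measure lborel U / measure lborel P =
      2 ^ CARD('n) * ((1 - \<eta>) / (1 + \<eta>)) ^ CARD('n)"
    using measure_symmetric_convex_body_pos[OF U] c(1) eta
    by (simp add: P_def measure_lborel_scaleR_image U'(1) c_def power_divide field_simps)
  finally show ?thesis .
qed

section \<open>Asymptotics\<close>

lemma eventually_bodies_to_infinity_absorb:
  fixes U :: "(real ^ 'n) set"
  assumes "bounded U"
  shows "\<forall>\<^sub>F V in bodies_to_infinity. symmetric_convex_body V \<and> (\<forall>u\<in>U. c *\<^sub>R u \<in> V)"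
proof -
  obtain b where b: "\<And>u. u \<in> U \<Longrightarrow> norm u \<le> b" using assms by (auto simp: bounded_iff)
  have "c *\<^sub>R u \<in> cball 0 (\<bar>c\<bar> * b)" if "u \<in> U" for u
    using b[OF that] by (simp add: mult_left_mono)
  then show ?thesis unfolding eventually_bodies_to_infinity by blast
qed

lemma eventually_doubling_constant_bounds:
  fixes U :: "(real ^ 'n) set"
  assumes U: "tile U" and eta: "0 < \<eta>" "\<eta> < 1"
  shows "\<forall>\<^sub>F V in bodies_to_infinity.
    ereal (2 ^ CARD('n) * ((1 - \<eta>) / (1 + \<eta>)) ^ CARD('n)) \<le> doubling_constant U V \<and>
    doubling_constant U V \<le> ereal (2 ^ CARD('n) * (1 + \<eta>) ^ CARD('n))"
proof -
  have body: "symmetric_convex_body U" using U by (simp add: tile_def)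
  then have "bounded U" by (simp add: symmetric_convex_bodyD(1) compact_imp_bounded)
  from eventually_bodies_to_infinity_absorb[OF this, of "1 / \<eta>"]
    eventually_bodies_to_infinity_absorb[OF this, of "2 / \<eta>"]
  show ?thesis
  proof eventually_elim
    case (elim V)
    with doubling_constant_le[OF body, of V \<eta>] doubling_constant_tile_ge[OF U, of V \<eta>] eta
    show ?case by blast
  qed
qed

theorem theorem4:
  fixes U :: "(real ^ 'n) set"
  assumes "symmetric_convex_body U" and "tile U"
  shows "\<exists>\<epsilon> :: (real ^ 'n) set \<Rightarrow> real.
    \<epsilon> \<in> o[bodies_to_infinity](\<lambda>_. 1) \<and>
    (\<forall>\<^sub>F V in bodies_to_infinity. doubling_constant U V = ereal (2 ^ CARD('n) * (1 + \<epsilon> V)))"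
proof -
  define \<epsilon> where "\<epsilon> V = real_of_ereal (doubling_constant U V) / 2 ^ CARD('n) - 1" for V
  have finite: "doubling_constant U V = ereal (2 ^ CARD('n) * (1 + \<epsilon> V))"
    if "ereal a \<le> doubling_constant U V" "doubling_constant U V \<le> ereal b" for V a b
    using that by (cases "doubling_constant U V") (auto simp: \<epsilon>_def)
  have "(\<epsilon> \<longlongrightarrow> 0) bodies_to_infinity"
    unfolding tendsto_iff
  proof (intro allI impI)
    fix e :: real assume e: "0 < e"
    have "((\<lambda>\<eta>. (1 + \<eta>) ^ CARD('n)) \<longlongrightarrow> (1 + 0) ^ CARD('n)) (at_right (0::real))"
      by (intro tendsto_intros)
    then have 1: "\<forall>\<^sub>F \<eta> in at_right (0::real). (1 + \<eta>) ^ CARD('n) < 1 + e"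
      using e by (intro order_tendstoD(2)) auto
    have "((\<lambda>\<eta>. ((1 - \<eta>) / (1 + \<eta>)) ^ CARD('n)) \<longlongrightarrow> ((1 - 0) / (1 + 0)) ^ CARD('n)) (at_right (0::real))"
      by (intro tendsto_intros) auto
    then have 2: "\<forall>\<^sub>F \<eta> in at_right (0::real). ((1 - \<eta>) / (1 + \<eta>)) ^ CARD('n) > 1 - e"
      using e by (intro order_tendstoD(1)) auto
    have 3: "\<forall>\<^sub>F \<eta> in at_right (0::real). \<eta> \<in> {0<..<1}"
      by (rule eventually_at_right_real) simp
    have "\<forall>\<^sub>F \<eta> in at_right (0::real). (1 + \<eta>) ^ CARD('n) < 1 + e \<and>
        ((1 - \<eta>) / (1 + \<eta>)) ^ CARD('n) > 1 - e \<and> \<eta> \<in> {0<..<1}"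
      using 1 2 3 by eventually_elim auto
    then obtain \<eta> :: real where eta: "(1 + \<eta>) ^ CARD('n) < 1 + e"
      "((1 - \<eta>) / (1 + \<eta>)) ^ CARD('n) > 1 - e" "0 < \<eta>" "\<eta> < 1"
      using eventually_happens[of _ "at_right (0::real)"] by fastforce
    from eventually_doubling_constant_bounds[OF assms(2) eta(3,4)]
    show "\<forall>\<^sub>F V in bodies_to_infinity. dist (\<epsilon> V) 0 < e"
    proof eventually_elim
      case (elim V)
      have "((1 - \<eta>) / (1 + \<eta>)) ^ CARD('n) \<le> 1 + \<epsilon> V" "1 + \<epsilon> V \<le> (1 + \<eta>) ^ CARD('n)"
        using elim finite[OF conjunct1[OF elim] conjunct2[OF elim]] by simp_all
      with eta show ?case by (simp add: dist_real_def abs_less_iff)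
    qed
  qed
  then have "\<epsilon> \<in> o[bodies_to_infinity](\<lambda>_. 1)"
    by (intro smalloI_tendsto) auto
  moreover have "\<forall>\<^sub>F V in bodies_to_infinity. doubling_constant U V = ereal (2 ^ CARD('n) * (1 + \<epsilon> V))"
    using eventually_doubling_constant_bounds[OF assms(2), of "1 / 2"]
    by (rule eventually_mono) (use finite in auto)
  ultimately show ?thesis by blast
qed

end
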